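(* Let $0<p<1$. For a martingale $F$ define the weighted maximal operator $$\widetilde{S}^{\ast,\nabla}F:=\sup_{n\in\mathbb{N}_+}\frac{|S_nF|}{2^{\rho(n)(1/p-1)}}.$$ Then $\widetilde{S}^{\ast,\nabla}$ is bounded from the martingale Hardy space $H_p(G)$ to the space $\text{weak-}L_p(G)$; that is, there exists a constant $c_p>0$ depending only on $p$ such that $$\big\|\widetilde{S}^{\ast,\nabla}F\big\|_{\text{weak-}L_p}\le c_p\|F\|_{H_p}\qquad\text{for all } F\in H_p(G).$$
   Context: $\mathbb{N}_+$ is the set of positive integers and $\mathbb{N}=\mathbb{N}_+\cup\{0\}$. Let $Z_2=\{0,1\}$ be the cyclic group of order 2 (discrete topology, each singleton of measure $1/2$), and let $G=\prod_{k\in\mathbb{N}}Z_2$ with the product topology and the product (normalized Haar) measure $\mu$. Elements are sequences $x=(x_0,x_1,\dots)$ with $x_k\in\{0,1\}$. Put $I_0(x):=G$ and $I_n(x):=\{y\in G: y_0=x_0,\dots,y_{n-1}=x_{n-1}\}$ for $n\ge1$ (dyadic intervals). Every $n\in\mathbb{N}$ is uniquely written as $n=\sum_{j=0}^\infty n_j2^j$ with $n_j\in\{0,1\}$, only finitely many nonzero. For $n\in\mathbb{N}_+$ let $[n]:=\min\{j:n_j\ne0\}$, $|n|:=\max\{j:n_j\neq0\}$, $\rho(n):=|n|-[n]$. Rademacher functions: $r_k(x):=(-1)^{x_k}$. Walsh functions: $w_n(x):=\prod_{k=0}^\infty r_k(x)^{n_k}$, $n\in\mathbb{N}$. Let $\zeta_n$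 be the $\sigma$-algebra generated by $\{I_n(x):x\in G\}$. A martingale $F=(F_n,n\in\mathbb{N})$ is a martingale with respect to $(\zeta_n)_{n\in\mathbb{N}}$. Its maximal function is $F^*:=\sup_{n\in\mathbb{N}}|F_n|$, and for $0<p<\infty$ the martingale Hardy space $H_p(G)$ consists of all martingales with $\|F\|_{H_p}:=\|F^*\|_p<\infty$, where $\|f\|_p^p:=\int_G|f|^p\,d\mu$. The Walsh-Fourier coefficients of $F$ are $\widehat F(k):=\lim_{n\to\infty}\int_GF_nw_k\,d\mu$ (the limit always exists), and the partial sums are $S_nF:=\sum_{k=0}^{n-1}\widehat F(k)w_k$ for $n\in\mathbb{N}_+$. The weak Lebesgue quasi-norm is $\|f\|_{\text{weak-}L_p}^p:=\sup_{\lambda>0}\lambda^p\mu(|f|>\lambda)$. *)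

theory Defs
  imports "HOL-Probability.Probability" "HOL-Library.Z2"
begin

text \<open>The group \<open>G\<close> is the full function type \<^typ>\<open>nat \<Rightarrow> bit\<close>, where \<^typ>\<open>bit\<close> is the
  two-element field. The product sigma-algebra is the Borel sigma-algebra of the product topology.\<close>

type_synonym cantor = "nat \<Rightarrow> bit"

definition haar :: "cantor measure" where
  "haar = (\<Pi>\<^sub>M k\<in>UNIV. uniform_count_measure (UNIV :: bit set))"

definition dyadic_interval :: "nat \<Rightarrow> cantor \<Rightarrow> cantor set" where
  "dyadic_interval n x = {y. \<forall>k<n. y k = x k}"

definition dyadic_filtration :: "nat \<Rightarrow> cantor measure" where
  "dyadic_filtration n = sigma UNIV (range (dyadic_interval n))"

text \<open>The binary digit \<open>n\<^sub>j\<close> is \<open>1\<close> if and only if \<^term>\<open>bit n j\<close>. The following is meant for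
  \<open>n > 0\<close> only, where the subtraction does not truncate.\<close>

definition rho :: "nat \<Rightarrow> nat" where
  "rho n = Max {j. bit n j} - Min {j. bit n j}"

definition rademacher :: "nat \<Rightarrow> cantor \<Rightarrow> real" where
  "rademacher k x = (if x k = 0 then 1 else - 1)"

definition walsh :: "nat \<Rightarrow> cantor \<Rightarrow> real" where
  "walsh n x = (\<Prod>k | bit n k. rademacher k x)"

text \<open>Scalars are taken in a complete separable normed field over the reals; the instances of
  interest (by the Gelfand--Mazur theorem the only ones) are \<^typ>\<open>real\<close> and \<^typ>\<open>complex\<close>.
  The last clause is \<open>E[F\<^sub>n | \<zeta>\<^sub>m] = F\<^sub>m\<close>, spelled out because
  \<^const>\<open>real_cond_exp\<close> covers only real-valued functions.\<close>

definition dyadic_martingale ::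
    "(nat \<Rightarrow> cantor \<Rightarrow> 'a::{real_normed_field, banach, second_countable_topology}) \<Rightarrow> bool" where
  "dyadic_martingale F \<longleftrightarrow>
     (\<forall>n. F n \<in> borel_measurable (dyadic_filtration n)) \<and>
     (\<forall>n. integrable haar (F n)) \<and>
     (\<forall>m n. m \<le> n \<longrightarrow> (\<forall>A \<in> sets (dyadic_filtration m).
        (LINT x:A|haar. F n x) = (LINT x:A|haar. F m x)))"

definition maximal_function ::
    "(nat \<Rightarrow> cantor \<Rightarrow> 'a::real_normed_vector) \<Rightarrow> cantor \<Rightarrow> ennreal" where
  "maximal_function F x = (SUP n. ennreal (norm (F n x)))"

text \<open>Real powers of extended nonnegative reals, for exponents \<open>a > 0\<close>.\<close>

definition ennreal_powr :: "ennreal \<Rightarrow> real \<Rightarrow> ennreal" where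
  "ennreal_powr t a = (if t = \<infinity> then \<infinity> else ennreal (enn2real t powr a))"

definition Lp_norm :: "real \<Rightarrow> (cantor \<Rightarrow> ennreal) \<Rightarrow> ennreal" where
  "Lp_norm p f = ennreal_powr (\<integral>\<^sup>+ x. ennreal_powr (f x) p \<partial>haar) (1 / p)"

definition weak_Lp_norm :: "real \<Rightarrow> (cantor \<Rightarrow> ennreal) \<Rightarrow> ennreal" where
  "weak_Lp_norm p f =
     ennreal_powr (SUP l\<in>{0::real<..}. ennreal (l powr p) * emeasure haar {x. f x > ennreal l}) (1 / p)"

definition Hp_norm :: "real \<Rightarrow> (nat \<Rightarrow> cantor \<Rightarrow> 'a::real_normed_vector) \<Rightarrow> ennreal" where
  "Hp_norm p F = Lp_norm p (maximal_function F)"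

definition Hp ::
    "real \<Rightarrow> (nat \<Rightarrow> cantor \<Rightarrow> 'a::{real_normed_field, banach, second_countable_topology}) set" where
  "Hp p = {F. dyadic_martingale F \<and> Hp_norm p F < \<infinity>}"

definition walsh_fourier_coeff ::
    "(nat \<Rightarrow> cantor \<Rightarrow> 'a::{real_normed_field, banach, second_countable_topology}) \<Rightarrow> nat \<Rightarrow> 'a" where
  "walsh_fourier_coeff F k = lim (\<lambda>n. LINT x|haar. walsh k x *\<^sub>R F n x)"

definition walsh_partial_sum ::
    "nat \<Rightarrow> (nat \<Rightarrow> cantor \<Rightarrow> 'a::{real_normed_field, banach, second_countable_topology}) \<Rightarrow>
      cantor \<Rightarrow> 'a" where
  "walsh_partial_sum n F x = (\<Sum>k<n. walsh k x *\<^sub>R walsh_fourier_coeff F k)"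

definition weighted_maximal_operator ::
    "real \<Rightarrow> (nat \<Rightarrow> cantor \<Rightarrow> 'a::{real_normed_field, banach, second_countable_topology}) \<Rightarrow>
      cantor \<Rightarrow> ennreal" where
  "weighted_maximal_operator p F x =
     (SUP n\<in>{0<..}. ennreal (norm (walsh_partial_sum n F x) / 2 powr (real (rho n) * (1 / p - 1))))"

end

theory Submission
  imports Defs
begin

text \<open>
  Write \<open>u = (F\<^sup>*)\<^sup>p\<close>, and let \<open>M u\<close> be the dyadic maximal function of \<open>u\<close>, the supremum of the
  averages of \<open>u\<close> over the dyadic intervals that contain the given point. The theorem follows from
  a pointwise bound: the weighted maximal operator is at most \<open>C (M u)\<^bsup>1/p\<^esup>\<close>, with \<open>C\<close> depending
  only on \<open>p\<close>. Since \<open>M\<close> is of weak type (1,1) (lemma \<open>dyadic_maximal_weak_type\<close>), the measure of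
  \<open>{M u > (l/C)\<^sup>p}\<close> is at most \<open>(C/l)\<^sup>p \<integral> u\<close>, which is the weak-type estimate.

  The pointwise bound rests on three facts, where \<open>N = |n| + 1\<close> and \<open>I\<^sub>j(x)\<close> is the dyadic interval
  of measure \<open>2\<^bsup>-j\<^esup>\<close> around \<open>x\<close>.

  \<^item> The Walsh-Dirichlet kernel satisfies \<open>|D\<^sub>n(x,t)| \<le> \<Sum>\<^sub>j 2\<^sup>j 1[t \<in> I\<^sub>j(x)]\<close>, where \<open>j\<close> runs over the
    binary digits equal to 1 of \<open>n\<close> (lemma \<open>abs_dirichlet_kernel_le\<close>). Hence \<open>|S\<^sub>n F(x)|\<close> is at most
    the sum over these \<open>j\<close> of the averages of \<open>|F\<^sub>N|\<close> over \<open>I\<^sub>j(x)\<close>.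

  \<^item> Because \<open>F\<^sub>N\<close> is constant on intervals of measure \<open>2\<^bsup>-N\<^esup>\<close>, its supremum over \<open>I\<^sub>j(x)\<close> is controlled
    by its \<open>L\<^sub>p\<close> norm there. So for \<open>p < 1\<close> the average of \<open>|F\<^sub>N|\<close> over \<open>I\<^sub>j(x)\<close> is at most
    \<open>2\<^bsup>(N-j)(1/p-1)\<^esup>\<close> times the \<open>1/p\<close>-th power of the average of \<open>|F\<^sub>N|\<^sup>p \<le> u\<close>
    (lemma \<open>dyadic_average_le_powr\<close>).

  \<^item> Summed over \<open>[n] \<le> j \<le> |n|\<close>, the factors \<open>2\<^bsup>(N-j)(1/p-1)\<^esup>\<close> form a geometric series dominated by
    its term \<open>j = [n]\<close>, which up to a constant is the weight \<open>2\<^bsup>\<rho>(n)(1/p-1)\<^esup>\<close>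
    (lemma \<open>sum_bits_powr_le\<close>).
\<close>

section \<open>Dyadic intervals and Haar measure\<close>

lemma mem_dyadic_interval_iff: "y \<in> dyadic_interval n x \<longleftrightarrow> (\<forall>k<n. y k = x k)"
  by (simp add: dyadic_interval_def)

lemma dyadic_interval_eq: "y \<in> dyadic_interval n x \<Longrightarrow> dyadic_interval n y = dyadic_interval n x"
  by (auto simp: dyadic_interval_def)

lemma dyadic_interval_antimono: "m \<le> n \<Longrightarrow> dyadic_interval n x \<subseteq> dyadic_interval m x"
  by (auto simp: dyadic_interval_def)

lemma UNIV_bit_eq: "(UNIV :: bit set) = {0, 1}"
  by (auto intro: bit.exhaust)

lemma prob_space_coin: "prob_space (uniform_count_measure (UNIV :: bit set))"
  by (rule prob_space_uniform_count_measure) (auto simp: UNIV_bit_eq)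

lemma prob_space_haar: "prob_space haar"
  unfolding haar_def by (rule prob_space_PiM) (rule prob_space_coin)

lemma space_haar [simp]: "space haar = UNIV"
  by (simp add: haar_def space_PiM space_uniform_count_measure PiE_UNIV_domain)

lemma measurable_coordinate [measurable]: "(\<lambda>x. x k) \<in> haar \<rightarrow>\<^sub>M count_space (UNIV :: bit set)"
proof -
  have "(\<lambda>x. x k) \<in> haar \<rightarrow>\<^sub>M uniform_count_measure (UNIV :: bit set)"
    unfolding haar_def by (rule measurable_component_singleton) simp
  moreover have "sets (uniform_count_measure (UNIV :: bit set)) = sets (count_space UNIV)"
    by (simp add: sets_uniform_count_measure)
  ultimately show ?thesis
    using measurable_cong_sets[OF refl[of "sets haar"]] by blast
qed

lemma pred_dyadic_interval [measurable]:
  "Measurable.pred (haar \<Otimes>\<^sub>M haar) (\<lambda>z. snd z \<in> dyadic_interval n (fst z))"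
proof -
  have [measurable]: "(\<lambda>z. fst z k) \<in> haar \<Otimes>\<^sub>M haar \<rightarrow>\<^sub>M count_space (UNIV :: bit set)"
    "(\<lambda>z. snd z k) \<in> haar \<Otimes>\<^sub>M haar \<rightarrow>\<^sub>M count_space (UNIV :: bit set)" for k
    by (rule measurable_compose[OF measurable_fst measurable_coordinate]
        measurable_compose[OF measurable_snd measurable_coordinate])+
  \<comment> \<open>Equality of two coordinates is split into events that concern a single coordinate each.\<close>
  have eq: "a = b \<longleftrightarrow> (a = 0 \<longleftrightarrow> b = 0)" for a b :: bit
    by (cases a; cases b) simp_all
  have "Measurable.pred (haar \<Otimes>\<^sub>M haar) (\<lambda>z. snd z k = fst z k)" for k
    by (subst eq) measurable
  then show ?thesis
    unfolding mem_dyadic_interval_iff by (intro pred_intros_countable pred_intros_imp')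
qed

lemma sets_dyadic_interval [measurable]: "dyadic_interval n x \<in> sets haar"
proof -
  have "Measurable.pred haar (\<lambda>y. y k = x k)" for k
    by measurable
  then have "{y \<in> space haar. \<forall>k<n. y k = x k} \<in> sets haar"
    by measurable
  then show ?thesis by (simp add: dyadic_interval_def)
qed

lemma emeasure_dyadic_interval: "2 ^ n * emeasure haar (dyadic_interval n x) = 1"
proof -
  interpret product_prob_space "\<lambda>_::nat. uniform_count_measure (UNIV :: bit set)" UNIV
    by (intro product_prob_spaceI prob_space_coin)
  have card: "card (UNIV :: bit set) = 2"
    by (simp add: UNIV_bit_eq)
  have "emeasure haar {y \<in> space haar. \<forall>k\<in>{..<n}. y k \<in> {x k}} =
      (\<Prod>k\<in>{..<n}. emeasure (uniform_count_measure (UNIV :: bit set)) {x k})"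
    unfolding haar_def by (rule emeasure_PiM_Collect) (auto simp: sets_uniform_count_measure)
  also have "\<dots> = (\<Prod>k\<in>{..<n}. ennreal (1/2))"
    by (intro prod.cong refl) (subst emeasure_uniform_count_measure, auto simp: card UNIV_bit_eq)
  also have "\<dots> = ennreal (1/2) ^ n"
    by simp
  also have "{y \<in> space haar. \<forall>k\<in>{..<n}. y k \<in> {x k}} = dyadic_interval n x"
    by (auto simp: dyadic_interval_def)
  finally have cell: "emeasure haar (dyadic_interval n x) = ennreal (1/2) ^ n" .
  have "ennreal 2 * ennreal (1/2) = ennreal (2 * (1/2))"
    by (rule ennreal_mult'[symmetric]) simp
  then have "2 * ennreal (1/2) = 1"
    by (simp only: ennreal_numeral) simp
  then show ?thesis
    by (simp only: cell power_mult_distrib[symmetric] power_one)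
qed

text \<open>The dyadic intervals of level \<open>n\<close> are finitely many and partition the space, so the
  sigma-algebra \<open>\<zeta>\<^sub>n\<close> consists exactly of their unions. The next lemmas give both inclusions, and
  the resulting description of \<open>\<zeta>\<^sub>n\<close>-measurable functions.\<close>

lemma sets_dyadic_filtration_saturated:
  assumes "A \<in> sets (dyadic_filtration n)" and "y \<in> dyadic_interval n x"
  shows "x \<in> A \<longleftrightarrow> y \<in> A"
proof -
  have "A \<in> sigma_sets UNIV (range (dyadic_interval n))"
    using assms(1) by (simp add: dyadic_filtration_def)
  then show ?thesis
  proof induction
    case (Basic a)
    with assms(2) show ?case by (auto simp: dyadic_interval_def)
  qed auto
qed

lemma finite_range_dyadic_interval: "finite (range (dyadic_interval n))"
proof -
  \<comment> \<open>\<open>?Z\<close> picks one representative of each interval: the sequence that vanishes from \<open>n\<close> on.\<close>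
  let ?Z = "{x :: cantor. \<forall>k. (k \<in> {..<n} \<longrightarrow> x k \<in> UNIV) \<and> (k \<notin> {..<n} \<longrightarrow> x k = 0)}"
  have "finite ?Z"
    by (rule finite_set_of_finite_funs) (simp_all add: UNIV_bit_eq)
  moreover have "range (dyadic_interval n) \<subseteq> dyadic_interval n ` ?Z"
  proof safe
    fix x :: cantor
    show "dyadic_interval n x \<in> dyadic_interval n ` ?Z"
      by (rule image_eqI[where x = "\<lambda>k. if k < n then x k else 0"]) (auto simp: dyadic_interval_def)
  qed
  ultimately show ?thesis
    by (meson finite_imageI finite_subset)
qed

lemma saturated_in_sets_dyadic_filtration:
  assumes "\<And>x y. x \<in> A \<Longrightarrow> y \<in> dyadic_interval n x \<Longrightarrow> y \<in> A"
  shows "A \<in> sets (dyadic_filtration n)"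
proof -
  have "A = \<Union>(dyadic_interval n ` A)"
    using assms by (auto simp: dyadic_interval_def)
  moreover have "countable (dyadic_interval n ` A)"
    by (intro countable_finite finite_subset[OF _ finite_range_dyadic_interval]) auto
  moreover have "dyadic_interval n ` A \<subseteq> sets (dyadic_filtration n)"
    by (auto simp: dyadic_filtration_def intro!: sigma_sets.Basic)
  ultimately show ?thesis
    by (metis sets.countable_Union)
qed

lemma dyadic_measurable_const:
  fixes f :: "cantor \<Rightarrow> 'a::t1_space"
  assumes "f \<in> borel_measurable (dyadic_filtration n)" and "y \<in> dyadic_interval n x"
  shows "f y = f x"
proof -
  have "f -` {f x} \<inter> space (dyadic_filtration n) \<in> sets (dyadic_filtration n)"
    by (rule measurable_sets[OF assms(1)]) simp
  from sets_dyadic_filtration_saturated[OF this assms(2)] show ?thesis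
    by (simp add: dyadic_filtration_def)
qed

section \<open>Weak type of the dyadic maximal function\<close>

definition dyadic_average :: "(cantor \<Rightarrow> ennreal) \<Rightarrow> nat \<Rightarrow> cantor \<Rightarrow> ennreal" where
  "dyadic_average u n x = 2 ^ n * (\<integral>\<^sup>+y. u y * indicator (dyadic_interval n x) y \<partial>haar)"

lemma measurable_dyadic_average [measurable]:
  assumes [measurable]: "u \<in> borel_measurable haar"
  shows "dyadic_average u n \<in> borel_measurable haar"
proof -
  interpret prob_space haar by (rule prob_space_haar)
  define K where "K z = u (snd z) * indicator {z. snd z \<in> dyadic_interval n (fst z)} z" for z
  have "K \<in> borel_measurable (haar \<Otimes>\<^sub>M haar)"
    unfolding K_def by measurable
  then have "(\<lambda>x. 2 ^ n * (\<integral>\<^sup>+y. K (x, y) \<partial>haar)) \<in> borel_measurable haar"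
    by (intro borel_measurable_times_ennreal borel_measurable_const borel_measurable_nn_integral_fst)
  moreover have "dyadic_average u n = (\<lambda>x. 2 ^ n * (\<integral>\<^sup>+y. K (x, y) \<partial>haar))"
    by (simp add: dyadic_average_def K_def fun_eq_iff indicator_def)
  ultimately show ?thesis
    by (simp only:)
qed

text \<open>This is the defining property of the conditional expectation of \<open>u\<close> given \<open>\<zeta>\<^sub>n\<close>. It follows
  from Tonelli's theorem, since \<open>y \<in> I\<^sub>n(x)\<close> is symmetric in \<open>x\<close> and \<open>y\<close> and integrating
  \<open>2\<^sup>n 1[y \<in> I\<^sub>n(x)]\<close> over \<open>x\<close> gives 1.\<close>

lemma nn_integral_dyadic_average:
  assumes [measurable]: "u \<in> borel_measurable haar" "E \<in> sets haar"
    and sat: "\<And>x y. y \<in> dyadic_interval n x \<Longrightarrow> x \<in> E \<longleftrightarrow> y \<in> E"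
  shows "(\<integral>\<^sup>+x. dyadic_average u n x * indicator E x \<partial>haar) = (\<integral>\<^sup>+x. u x * indicator E x \<partial>haar)"
proof -
  interpret prob_space haar by (rule prob_space_haar)
  interpret pair_sigma_finite haar haar ..
  define K where "K = (\<lambda>x y. 2 ^ n * (u y * indicator E y) *
    indicator {z. snd z \<in> dyadic_interval n (fst z)} (x, y) :: ennreal)"
  have meas: "case_prod K \<in> borel_measurable (haar \<Otimes>\<^sub>M haar)"
    unfolding K_def case_prod_beta by measurable
  have "dyadic_average u n x * indicator E x = (\<integral>\<^sup>+y. K x y \<partial>haar)" for x
  proof -
    have "dyadic_average u n x * indicator E x =
        (\<integral>\<^sup>+y. 2 ^ n * (u y * indicator (dyadic_interval n x) y) \<partial>haar) * indicator E x"
      unfolding dyadic_average_def by (subst nn_integral_cmult) simp_all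
    also have "\<dots> = (\<integral>\<^sup>+y. 2 ^ n * (u y * indicator (dyadic_interval n x) y) * indicator E x \<partial>haar)"
      by (rule nn_integral_multc[symmetric]) simp
    also have "\<dots> = (\<integral>\<^sup>+y. K x y \<partial>haar)"
    proof (intro nn_integral_cong)
      fix y
      show "2 ^ n * (u y * indicator (dyadic_interval n x) y) * indicator E x = K x y"
        using sat[of y x] by (auto simp: K_def indicator_def)
    qed
    finally show ?thesis .
  qed
  then have "(\<integral>\<^sup>+x. dyadic_average u n x * indicator E x \<partial>haar) = (\<integral>\<^sup>+x. \<integral>\<^sup>+y. K x y \<partial>haar \<partial>haar)"
    by simp
  also have "\<dots> = (\<integral>\<^sup>+y. \<integral>\<^sup>+x. K x y \<partial>haar \<partial>haar)"
    by (rule Fubini'[OF meas, symmetric])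
  also have "\<dots> = (\<integral>\<^sup>+y. u y * indicator E y \<partial>haar)"
  proof (intro nn_integral_cong)
    fix y
    have "(\<integral>\<^sup>+x. K x y \<partial>haar) =
        (\<integral>\<^sup>+x. (2 ^ n * (u y * indicator E y)) * indicator (dyadic_interval n y) x \<partial>haar)"
      by (intro nn_integral_cong) (auto simp: K_def indicator_def dyadic_interval_def)
    also have "\<dots> = (u y * indicator E y) * (2 ^ n * emeasure haar (dyadic_interval n y))"
      by (subst nn_integral_cmult_indicator) (simp_all add: mult_ac)
    finally show "(\<integral>\<^sup>+x. K x y \<partial>haar) = u y * indicator E y"
      by (simp add: emeasure_dyadic_interval)
  qed
  finally show ?thesis .
qed

text \<open>Doob's weak-type inequality. Split the set by the first level \<open>n\<close> at which the average exceeds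
  \<open>l\<close>. The resulting pieces \<open>E n\<close> are disjoint and \<open>\<zeta>\<^sub>n\<close>-measurable, so on \<open>E n\<close> the averages
  of \<open>u\<close>, all larger than \<open>l\<close>, have the same integral as \<open>u\<close> itself.\<close>

lemma dyadic_maximal_weak_type:
  assumes [measurable]: "u \<in> borel_measurable haar"
  shows "l * emeasure haar {x. l < (SUP n. dyadic_average u n x)} \<le> (\<integral>\<^sup>+x. u x \<partial>haar)"
proof -
  define E where "E n = {x. l < dyadic_average u n x \<and> (\<forall>i<n. \<not> l < dyadic_average u i x)}" for n
  have E_sets [measurable]: "E n \<in> sets haar" for n
  proof -
    have "{x \<in> space haar. l < dyadic_average u n x \<and> (\<forall>i<n. \<not> l < dyadic_average u i x)} \<in> sets haar"
      by measurable
    then show ?thesis by (simp add: E_def)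
  qed
  have disj: "disjoint_family E"
    by (auto simp: disjoint_family_on_def E_def neq_iff)
  have union: "{x. l < (SUP n. dyadic_average u n x)} = (\<Union>n. E n)"
  proof -
    have "(\<exists>n. l < dyadic_average u n x) \<longleftrightarrow> (\<exists>n. x \<in> E n)" for x
      unfolding E_def using exists_least_iff[of "\<lambda>n. l < dyadic_average u n x"] by simp
    then show ?thesis by (auto simp: less_SUP_iff)
  qed
  have level: "l * emeasure haar (E n) \<le> (\<integral>\<^sup>+x. u x * indicator (E n) x \<partial>haar)" for n
  proof -
    have sat: "x \<in> E n \<longleftrightarrow> y \<in> E n" if "y \<in> dyadic_interval n x" for x y
    proof -
      have "dyadic_interval i y = dyadic_interval i x" if "i \<le> n" for i
        using \<open>y \<in> _\<close> that by (intro dyadic_interval_eq) (auto simp: dyadic_interval_def)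
      then have "dyadic_average u i y = dyadic_average u i x" if "i \<le> n" for i
        using that by (simp add: dyadic_average_def)
      then show ?thesis by (auto simp: E_def)
    qed
    have "l * emeasure haar (E n) = (\<integral>\<^sup>+x. l * indicator (E n) x \<partial>haar)"
      by (simp add: nn_integral_cmult_indicator)
    also have "\<dots> \<le> (\<integral>\<^sup>+x. dyadic_average u n x * indicator (E n) x \<partial>haar)"
      by (intro nn_integral_mono) (auto simp: E_def indicator_def)
    also have "\<dots> = (\<integral>\<^sup>+x. u x * indicator (E n) x \<partial>haar)"
      by (rule nn_integral_dyadic_average[OF assms E_sets sat])
    finally show ?thesis .
  qed
  have "l * emeasure haar (\<Union>n. E n) = (\<Sum>n. l * emeasure haar (E n))"
    by (subst suminf_emeasure[symmetric]) (auto simp: disj)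
  also have "\<dots> \<le> (\<Sum>n. \<integral>\<^sup>+x. u x * indicator (E n) x \<partial>haar)"
    by (intro suminf_le level) auto
  also have "\<dots> = (\<integral>\<^sup>+x. u x * indicator (\<Union>n. E n) x \<partial>haar)"
    by (subst nn_integral_suminf[symmetric]) (simp_all add: suminf_indicator[OF disj])
  also have "\<dots> \<le> (\<integral>\<^sup>+x. u x \<partial>haar)"
    by (intro nn_integral_mono) (auto simp: indicator_def)
  finally show ?thesis by (simp add: union)
qed

section \<open>The Walsh-Dirichlet kernel\<close>

lemma less_power_2_iff_bits: "n < 2 ^ N \<longleftrightarrow> (\<forall>j. bit n j \<longrightarrow> j < N)" for n :: nat
proof -
  have "n < 2 ^ N \<longleftrightarrow> take_bit N n = n"
    by (simp add: take_bit_nat_eq_self_iff)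
  also have "\<dots> \<longleftrightarrow> (\<forall>j. bit n j \<longrightarrow> j < N)"
    by (auto simp: bit_eq_iff bit_take_bit_iff)
  finally show ?thesis .
qed

lemma finite_bits: "finite {j. bit n j}" for n :: nat
  by (rule finite_subset[of _ "{..<n}"]) (use less_power_2_iff_bits[of n n] in auto)

lemma bits_double: "{j. bit (2 * n :: nat) j} = Suc ` {j. bit n j}"
  by (auto simp: bit_double_iff gr0_conv_Suc image_iff)

lemma bits_Suc_double: "{j. bit (Suc (2 * n)) j} = insert 0 (Suc ` {j. bit n j})"
proof (rule set_eqI)
  show "j \<in> {j. bit (Suc (2 * n)) j} \<longleftrightarrow> j \<in> insert 0 (Suc ` {j. bit n j})" for j
    by (cases j) (auto simp: bit_Suc bit_0)
qed

lemma walsh_double: "walsh (2 * n) x = walsh n (\<lambda>k. x (Suc k))"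
  by (simp add: walsh_def bits_double prod.reindex rademacher_def)

lemma walsh_Suc_double: "walsh (Suc (2 * n)) x = rademacher 0 x * walsh n (\<lambda>k. x (Suc k))"
  by (simp add: walsh_def bits_Suc_double prod.reindex finite_bits rademacher_def)

lemma abs_walsh [simp]: "\<bar>walsh n x\<bar> = 1"
  unfolding walsh_def abs_prod by (rule prod.neutral) (simp add: rademacher_def)

definition dirichlet_kernel :: "nat \<Rightarrow> cantor \<Rightarrow> cantor \<Rightarrow> real" where
  "dirichlet_kernel n x t = (\<Sum>k<n. walsh k x * walsh k t)"

text \<open>The recursion on the last binary digit: \<open>w\<^bsub>2k\<^esub>\<close> and \<open>w\<^bsub>2k+1\<^esub>\<close> are \<open>w\<^sub>k\<close> of the shifted sequence,
  the latter multiplied by \<open>r\<^sub>0\<close>, so each pair contributes the factor \<open>1 + r\<^sub>0(x) r\<^sub>0(t)\<close>, which is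
  0 or 2.\<close>

lemma dirichlet_kernel_double:
  "dirichlet_kernel (2 * n) x t =
    (if t 0 = x 0 then 2 else 0) * dirichlet_kernel n (\<lambda>k. x (Suc k)) (\<lambda>k. t (Suc k))"
proof (induction n)
  case (Suc n)
  let ?r = "1 + rademacher 0 x * rademacher 0 t"
  have "dirichlet_kernel (2 * Suc n) x t = dirichlet_kernel (2 * n) x t +
      ?r * (walsh n (\<lambda>k. x (Suc k)) * walsh n (\<lambda>k. t (Suc k)))"
    by (simp add: dirichlet_kernel_def walsh_double walsh_Suc_double distrib_right)
  also have "?r = (if t 0 = x 0 then 2 else 0)"
    by (cases "x 0"; cases "t 0") (auto simp: rademacher_def)
  finally show ?case
    unfolding Suc by (simp add: dirichlet_kernel_def algebra_simps)
qed (simp add: dirichlet_kernel_def)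

lemma sum_bits_double_indicator:
  "(\<Sum>j | bit (2 * n) j. 2 ^ j * indicator (dyadic_interval j x) t :: real) =
    (if t 0 = x 0 then 2 else 0) *
    (\<Sum>j | bit n j. 2 ^ j * indicator (dyadic_interval j (\<lambda>k. x (Suc k))) (\<lambda>k. t (Suc k)))"
  for n :: nat
proof -
  have "indicator (dyadic_interval (Suc j) x) t = (if t 0 = x 0 then 1 else 0 :: real) *
      indicator (dyadic_interval j (\<lambda>k. x (Suc k))) (\<lambda>k. t (Suc k))" for j
    by (auto simp: indicator_def dyadic_interval_def All_less_Suc2)
  then show ?thesis
    by (simp add: bits_double sum.reindex mult.assoc sum_distrib_left[symmetric])
qed

text \<open>Kernel and bound obey the same recursion when a digit 0 is appended to \<open>n\<close>. Appending a digit 1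
  instead adds one term of modulus 1 to the kernel and the term \<open>j = 0\<close>, which is 1, to the
  bound. Only the digits equal to 1 enter, so the sum starts at \<open>j = [n]\<close>; this is what makes the
  final estimate depend on \<open>\<rho>(n)\<close> and not on \<open>|n|\<close>.\<close>

lemma abs_dirichlet_kernel_le:
  "\<bar>dirichlet_kernel n x t\<bar> \<le> (\<Sum>j | bit n j. 2 ^ j * indicator (dyadic_interval j x) t)"
proof (induction n arbitrary: x t rule: nat_bit_induct)
  case zero
  show ?case by (simp add: dirichlet_kernel_def)
next
  case (even n)
  then show ?case
    by (simp add: dirichlet_kernel_double sum_bits_double_indicator abs_mult)
next
  case (odd n)
  let ?B = "\<lambda>n. \<Sum>j | bit n j. 2 ^ j * indicator (dyadic_interval j x) t :: real"
  have "\<bar>dirichlet_kernel (2 * n) x t\<bar> \<le> ?B (2 * n)"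
    using odd.IH by (simp add: dirichlet_kernel_double sum_bits_double_indicator abs_mult)
  moreover have "\<bar>dirichlet_kernel (Suc (2 * n)) x t\<bar> \<le> \<bar>dirichlet_kernel (2 * n) x t\<bar> + 1"
    using abs_triangle_ineq[of "dirichlet_kernel (2 * n) x t" "walsh (2 * n) x * walsh (2 * n) t"]
    by (simp add: dirichlet_kernel_def abs_mult)
  moreover have "?B (Suc (2 * n)) = ?B (2 * n) + 1"
    by (simp only: bits_Suc_double bits_double, subst sum.insert)
       (auto simp: finite_bits mem_dyadic_interval_iff)
  ultimately show ?case by simp
qed

section \<open>Partial sums as integrals against the kernel\<close>

lemma walsh_const_on_dyadic_interval:
  assumes "k < 2 ^ N" and "y \<in> dyadic_interval N x"
  shows "walsh k y = walsh k x"
  using assms unfolding walsh_def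
  by (intro prod.cong) (auto simp: less_power_2_iff_bits rademacher_def dyadic_interval_def)

lemma dyadic_filtration_subset_haar: "sets (dyadic_filtration n) \<subseteq> sets haar"
  using sets.sigma_sets_subset[of "range (dyadic_interval n)" haar]
  by (simp add: dyadic_filtration_def image_subset_iff sets_dyadic_interval)

lemma walsh_level_set: "k < 2 ^ N \<Longrightarrow> {x. walsh k x = 1} \<in> sets (dyadic_filtration N)"
  by (rule saturated_in_sets_dyadic_filtration) (use walsh_const_on_dyadic_interval in fastforce)

text \<open>As \<open>w\<^sub>k\<close> takes only the values 1 and -1, it equals \<open>2 1\<^sub>A - 1\<close> with \<open>A = {w\<^sub>k = 1}\<close>. This reduces
  Walsh coefficients to integrals over sets, the form in which the martingale property is given.\<close>

lemma walsh_integral: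
  fixes f :: "cantor \<Rightarrow> 'a::{real_normed_field, banach, second_countable_topology}"
  assumes f: "integrable haar f"
  shows "integrable haar (\<lambda>x. walsh k x *\<^sub>R f x)"
    and "(LINT x|haar. walsh k x *\<^sub>R f x) =
      2 *\<^sub>R (LINT x:{x. walsh k x = 1}|haar. f x) - (LINT x:UNIV|haar. f x)"
proof -
  have "k < 2 ^ k" by simp
  then have A: "{x. walsh k x = 1} \<in> sets haar"
    using walsh_level_set dyadic_filtration_subset_haar by blast
  have split: "walsh k x *\<^sub>R f x = 2 *\<^sub>R (indicator {x. walsh k x = 1} x *\<^sub>R f x) - f x" for x
  proof -
    have "walsh k x = 1 \<or> walsh k x = -1"
      using abs_walsh[of k x] by linarith
    then show ?thesis by (auto simp: scaleR_2)
  qed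
  have int: "integrable haar (\<lambda>x. indicator {x. walsh k x = 1} x *\<^sub>R f x)"
    by (rule integrable_mult_indicator[OF A f])
  show "integrable haar (\<lambda>x. walsh k x *\<^sub>R f x)"
    unfolding split
    by (intro Bochner_Integration.integrable_diff integrable_scaleR_right f int)
  show "(LINT x|haar. walsh k x *\<^sub>R f x) =
      2 *\<^sub>R (LINT x:{x. walsh k x = 1}|haar. f x) - (LINT x:UNIV|haar. f x)"
    unfolding split set_lebesgue_integral_def
    by (subst Bochner_Integration.integral_diff) (use f int in \<open>simp_all del: scaleR_scaleR\<close>)
qed

text \<open>The limit that defines a coefficient is attained: for \<open>k < 2\<^sup>N\<close> the set \<open>{w\<^sub>k = 1}\<close> belongs to
  \<open>\<zeta>\<^sub>N\<close>, so the martingale property makes the sequence constant from \<open>N\<close> on.\<close>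

lemma walsh_fourier_coeff_eq:
  assumes F: "dyadic_martingale F" and k: "k < 2 ^ N"
  shows "walsh_fourier_coeff F k = (LINT x|haar. walsh k x *\<^sub>R F N x)"
proof -
  have int: "integrable haar (F n)" for n
    using F unfolding dyadic_martingale_def by blast
  have mart: "(LINT x:A|haar. F n x) = (LINT x:A|haar. F N x)"
    if "N \<le> n" "A \<in> sets (dyadic_filtration N)" for n A
    using F that unfolding dyadic_martingale_def by blast
  have univ: "UNIV \<in> sets (dyadic_filtration N)"
    by (rule saturated_in_sets_dyadic_filtration) simp
  have "(LINT x|haar. walsh k x *\<^sub>R F n x) = (LINT x|haar. walsh k x *\<^sub>R F N x)" if "N \<le> n" for n
    by (simp only: walsh_integral(2)[OF int] mart[OF that walsh_level_set[OF k]] mart[OF that univ])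
  then have "(\<lambda>n. LINT x|haar. walsh k x *\<^sub>R F n x) \<longlonglongrightarrow> (LINT x|haar. walsh k x *\<^sub>R F N x)"
    by (intro tendsto_eventually eventually_sequentiallyI[of N])
  then show ?thesis
    unfolding walsh_fourier_coeff_def by (rule limI)
qed

lemma walsh_partial_sum_eq:
  assumes F: "dyadic_martingale F" and n: "n \<le> 2 ^ N"
  shows "walsh_partial_sum n F x = (LINT t|haar. dirichlet_kernel n x t *\<^sub>R F N t)"
proof -
  have int: "integrable haar (F N)"
    using F by (simp add: dyadic_martingale_def)
  have "walsh_partial_sum n F x = (\<Sum>k<n. LINT t|haar. walsh k x *\<^sub>R (walsh k t *\<^sub>R F N t))"
    unfolding walsh_partial_sum_def using n
    by (intro sum.cong refl)
       (simp add: walsh_fourier_coeff_eq[OF F, of _ N] del: scaleR_scaleR)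
  also have "\<dots> = (LINT t|haar. (\<Sum>k<n. walsh k x *\<^sub>R (walsh k t *\<^sub>R F N t)))"
    by (rule Bochner_Integration.integral_sum[symmetric])
       (intro integrable_scaleR_right walsh_integral(1)[OF int])
  also have "\<dots> = (LINT t|haar. dirichlet_kernel n x t *\<^sub>R F N t)"
    by (simp add: dirichlet_kernel_def scaleR_sum_left)
  finally show ?thesis .
qed

lemma norm_walsh_partial_sum_le:
  assumes F: "dyadic_martingale F" and n: "n \<le> 2 ^ N"
  shows "ennreal (norm (walsh_partial_sum n F x)) \<le>
    (\<Sum>j | bit n j. dyadic_average (\<lambda>t. ennreal (norm (F N t))) j x)"
proof -
  have int: "integrable haar (F N)"
    using F by (simp add: dyadic_martingale_def)
  then have [measurable]: "F N \<in> borel_measurable haar" by simp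
  have "integrable haar (\<lambda>t. dirichlet_kernel n x t *\<^sub>R F N t)"
    unfolding dirichlet_kernel_def scaleR_sum_left scaleR_scaleR[symmetric]
    by (intro Bochner_Integration.integrable_sum integrable_scaleR_right walsh_integral(1)[OF int])
  then have "ennreal (norm (walsh_partial_sum n F x)) \<le>
      (\<integral>\<^sup>+t. ennreal (norm (dirichlet_kernel n x t *\<^sub>R F N t)) \<partial>haar)"
    unfolding walsh_partial_sum_eq[OF F n] by (rule integral_norm_bound_ennreal)
  also have "\<dots> \<le> (\<integral>\<^sup>+t. (\<Sum>j | bit n j. 2 ^ j *
      (ennreal (norm (F N t)) * indicator (dyadic_interval j x) t)) \<partial>haar)"
  proof (intro nn_integral_mono)
    fix t
    have "norm (dirichlet_kernel n x t *\<^sub>R F N t) \<le>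
        (\<Sum>j | bit n j. 2 ^ j * indicator (dyadic_interval j x) t) * norm (F N t)"
      by (simp add: mult_right_mono abs_dirichlet_kernel_le)
    also have "\<dots> = (\<Sum>j | bit n j. 2 ^ j * (norm (F N t) * indicator (dyadic_interval j x) t))"
      unfolding sum_distrib_right by (intro sum.cong refl) (simp add: mult_ac)
    finally have "ennreal (norm (dirichlet_kernel n x t *\<^sub>R F N t)) \<le>
        ennreal (\<Sum>j | bit n j. 2 ^ j * (norm (F N t) * indicator (dyadic_interval j x) t))"
      by (rule ennreal_leI)
    also have "\<dots> = (\<Sum>j | bit n j. ennreal (2 ^ j * (norm (F N t) * indicator (dyadic_interval j x) t)))"
      by (subst sum_ennreal) auto
    also have "\<dots> = (\<Sum>j | bit n j. 2 ^ j * (ennreal (norm (F N t)) * indicator (dyadic_interval j x) t))"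
      by (intro sum.cong refl) (auto simp: ennreal_mult ennreal_power[symmetric] indicator_def)
    finally show "ennreal (norm (dirichlet_kernel n x t *\<^sub>R F N t)) \<le>
        (\<Sum>j | bit n j. 2 ^ j * (ennreal (norm (F N t)) * indicator (dyadic_interval j x) t))" .
  qed
  also have "\<dots> = (\<Sum>j | bit n j. dyadic_average (\<lambda>t. ennreal (norm (F N t))) j x)"
    unfolding dyadic_average_def by (simp add: nn_integral_sum nn_integral_cmult)
  finally show ?thesis .
qed

section \<open>Comparing averages with averages of \<open>p\<close>-th powers\<close>

text \<open>A reverse Hoelder inequality for functions \<open>g\<close> that are constant on intervals of level \<open>N\<close>. For
  \<open>y \<in> I\<^sub>j(x)\<close>, the interval \<open>I\<^sub>N(y)\<close> alone contributes \<open>2\<^bsup>-N\<^esup> g(y)\<^sup>p\<close> to the integral of \<open>u\<close> over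
  \<open>I\<^sub>j(x)\<close>, hence \<open>g\<^sup>p \<le> 2\<^bsup>N-j\<^esup> a\<close> on \<open>I\<^sub>j(x)\<close>. It remains to write \<open>g = (g\<^sup>p)\<^bsup>1/p-1\<^esup> g\<^sup>p\<close>, to bound the first
  factor pointwise, where \<open>p < 1\<close> makes the exponent positive, and to average the second one.\<close>

lemma dyadic_average_le_powr:
  fixes g :: "cantor \<Rightarrow> real"
  assumes p: "0 < p" "p < 1" and j: "j \<le> N" and a: "0 \<le> a"
    and [measurable]: "u \<in> borel_measurable haar" "g \<in> borel_measurable haar"
    and g: "\<And>y. 0 \<le> g y" "\<And>y z. z \<in> dyadic_interval N y \<Longrightarrow> g z = g y"
    and gu: "\<And>y. ennreal (g y powr p) \<le> u y"
    and avg: "dyadic_average u j x \<le> ennreal a"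
  shows "dyadic_average (\<lambda>t. ennreal (g t)) j x \<le>
    ennreal (2 powr (real (N - j) * (1 / p - 1)) * a powr (1 / p))"
proof -
  define b where "b = 2 ^ (N - j) * a"
  have b: "0 \<le> b" using a by (simp add: b_def)
  have pointwise: "g y powr p \<le> b" if y: "y \<in> dyadic_interval j x" for y
  proof -
    have sub: "dyadic_interval N y \<subseteq> dyadic_interval j x"
      using dyadic_interval_antimono[OF j, of y] dyadic_interval_eq[OF y] by simp
    have "ennreal (g y powr p) = ennreal (g y powr p) * (2 ^ N * emeasure haar (dyadic_interval N y))"
      by (simp add: emeasure_dyadic_interval)
    also have "\<dots> = 2 ^ N * (\<integral>\<^sup>+t. ennreal (g y powr p) * indicator (dyadic_interval N y) t \<partial>haar)"
      by (subst nn_integral_cmult_indicator) (simp_all add: mult_ac)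
    also have "\<dots> \<le> 2 ^ N * (\<integral>\<^sup>+t. u t * indicator (dyadic_interval j x) t \<partial>haar)"
    proof (intro mult_left_mono nn_integral_mono)
      fix t
      show "ennreal (g y powr p) * indicator (dyadic_interval N y) t \<le>
          u t * indicator (dyadic_interval j x) t"
        using sub gu[of t] g(2)[of t y] by (auto simp: indicator_def)
    qed simp
    also have "\<dots> = 2 ^ (N - j) * dyadic_average u j x"
      using j by (simp add: dyadic_average_def mult.assoc[symmetric] power_add[symmetric])
    also have "\<dots> \<le> 2 ^ (N - j) * ennreal a"
      by (intro mult_left_mono avg) simp
    also have "\<dots> = ennreal b"
      using a by (simp add: b_def ennreal_mult ennreal_power[symmetric])
    finally show ?thesis using b by simp
  qed
  have "g y \<le> b powr (1 / p - 1) * g y powr p" if "y \<in> dyadic_interval j x" for y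
  proof -
    have "g y = (g y powr p) powr (1 / p - 1) * g y powr p"
      using p g(1)[of y] by (cases "g y = 0") (simp_all add: powr_powr powr_add[symmetric] field_simps)
    also have "\<dots> \<le> b powr (1 / p - 1) * g y powr p"
      using p pointwise[OF that] by (intro mult_right_mono powr_mono2) (auto simp: field_simps)
    finally show ?thesis .
  qed
  then have "ennreal (g y) \<le> ennreal (b powr (1 / p - 1)) * u y" if "y \<in> dyadic_interval j x" for y
    using order_trans[OF _ mult_left_mono[OF gu[of y], of "ennreal (b powr (1 / p - 1))"]] that
    by (metis ennreal_leI ennreal_mult' powr_ge_zero zero_le)
  then have "(\<integral>\<^sup>+t. ennreal (g t) * indicator (dyadic_interval j x) t \<partial>haar) \<le>
      (\<integral>\<^sup>+t. ennreal (b powr (1 / p - 1)) * (u t * indicator (dyadic_interval j x) t) \<partial>haar)"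
    by (intro nn_integral_mono) (auto simp: indicator_def)
  also have "\<dots> = ennreal (b powr (1 / p - 1)) * (\<integral>\<^sup>+t. u t * indicator (dyadic_interval j x) t \<partial>haar)"
    by (rule nn_integral_cmult) measurable
  finally have "dyadic_average (\<lambda>t. ennreal (g t)) j x \<le>
      ennreal (b powr (1 / p - 1)) * dyadic_average u j x"
    unfolding dyadic_average_def by (subst mult.left_commute) (rule mult_left_mono, simp_all)
  also have "\<dots> \<le> ennreal (b powr (1 / p - 1)) * ennreal a"
    by (intro mult_left_mono avg) simp
  also have "\<dots> = ennreal (b powr (1 / p - 1) * a)"
    using a by (simp add: ennreal_mult)
  also have "b powr (1 / p - 1) * a = 2 powr (real (N - j) * (1 / p - 1)) * a powr (1 / p)"
  proof (cases "a = 0")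
    case False
    with a have "a powr (1 / p - 1) * a = a powr (1 / p)"
      by (simp add: powr_diff)
    moreover have "b powr (1 / p - 1) = 2 powr (real (N - j) * (1 / p - 1)) * a powr (1 / p - 1)"
      using a by (simp add: b_def powr_mult powr_powr[symmetric] powr_realpow)
    ultimately show ?thesis by simp
  qed simp
  finally show ?thesis .
qed

lemma ennreal_powr_ennreal: "0 \<le> r \<Longrightarrow> ennreal_powr (ennreal r) a = ennreal (r powr a)"
  by (simp add: ennreal_powr_def)

lemma ennreal_powr_mono: "s \<le> t \<Longrightarrow> 0 \<le> a \<Longrightarrow> ennreal_powr s a \<le> ennreal_powr t a"
  by (auto simp: ennreal_powr_def less_top intro!: ennreal_leI powr_mono2 enn2real_mono
      dest: le_less_trans)

lemma measurable_ennreal_powr [measurable]: "(\<lambda>t. ennreal_powr t a) \<in> borel_measurable borel"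
  unfolding ennreal_powr_def by measurable

text \<open>If the binary digit \<open>j\<close> of \<open>n\<close> is 1, the exponent \<open>|n| + 1 - j\<close> equals \<open>\<rho>(n) + 1 - (j - [n])\<close>, so the sum is
  \<open>2\<^bsup>(\<rho>(n)+1)q\<^esup>\<close> times a part of the geometric series with ratio \<open>2\<^bsup>-q\<^esup>\<close>.\<close>

lemma sum_bits_powr_le:
  assumes q: "0 < q"
  shows "(\<Sum>j | bit n j. 2 powr (real (Suc (Max {j. bit n j}) - j) * q)) \<le>
    2 powr q / (1 - 2 powr - q) * 2 powr (real (rho n) * q)"
proof -
  define s M z where "s = Min {j. bit n j}" and "M = Max {j. bit n j}" and "z = 2 powr - q"
  have bounds: "s \<le> j \<and> j \<le> M" if "bit n j" for j
    using that by (simp add: s_def M_def finite_bits)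
  have z: "0 < z" "z < 1"
    using q by (auto simp: z_def powr_less_one)
  have "(\<Sum>j | bit n j. z ^ (j - s)) = (\<Sum>i \<in> (\<lambda>j. j - s) ` {j. bit n j}. z ^ i)"
  proof (rule sum.reindex[symmetric, unfolded o_def])
    show "inj_on (\<lambda>j. j - s) {j. bit n j}"
      using bounds by (intro inj_onI) (metis le_add_diff_inverse mem_Collect_eq)
  qed
  also have "\<dots> \<le> (\<Sum>i. z ^ i)"
    using z by (intro sum_le_suminf) (auto simp: finite_bits)
  also have "\<dots> = 1 / (1 - z)"
    using z by (simp add: suminf_geometric)
  finally have geo: "(\<Sum>j | bit n j. z ^ (j - s)) \<le> 1 / (1 - z)" .
  have "2 powr (real (Suc M - j) * q) = 2 powr q * 2 powr (real (rho n) * q) * z ^ (j - s)"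
    if "bit n j" for j
  proof -
    have "rho n = M - s"
      by (simp add: rho_def M_def s_def)
    then have "real (Suc M - j) * q = q + real (rho n) * q + (- q) * real (j - s)"
      using bounds[OF that] by (simp add: of_nat_diff algebra_simps)
    then have "2 powr (real (Suc M - j) * q) =
        2 powr q * 2 powr (real (rho n) * q) * 2 powr ((- q) * real (j - s))"
      by (simp only: powr_add)
    also have "2 powr ((- q) * real (j - s)) = z ^ (j - s)"
      using z by (simp only: z_def powr_powr[symmetric] powr_realpow)
    finally show ?thesis .
  qed
  then have "(\<Sum>j | bit n j. 2 powr (real (Suc M - j) * q)) =
      2 powr q * 2 powr (real (rho n) * q) * (\<Sum>j | bit n j. z ^ (j - s))"
    by (simp add: sum_distrib_left)
  also have "\<dots> \<le> 2 powr q * 2 powr (real (rho n) * q) * (1 / (1 - z))"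
    by (intro mult_left_mono geo) simp
  finally show ?thesis by (simp add: M_def z_def)
qed

section \<open>The weighted maximal operator\<close>

definition maximal_constant :: "real \<Rightarrow> real" where
  "maximal_constant p = 2 powr (1 / p - 1) / (1 - 2 powr - (1 / p - 1))"

lemma maximal_constant_pos: "0 < p \<Longrightarrow> p < 1 \<Longrightarrow> 0 < maximal_constant p"
  unfolding maximal_constant_def by (intro divide_pos_pos) (simp_all add: powr_less_one)

text \<open>The pointwise bound by \<open>C (M u)\<^bsup>1/p\<^esup>\<close>, in the form in which it is applied: a real bound \<open>a\<close> for
  all averages of \<open>u\<close> around \<open>x\<close> takes the place of \<open>M u(x)\<close>, which may be infinite.\<close>

lemma weighted_maximal_operator_le:
  assumes p: "0 < p" "p < 1" and F: "dyadic_martingale F" and a: "0 \<le> a"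
    and u [measurable]: "u \<in> borel_measurable haar"
    and Fu: "\<And>N y. ennreal (norm (F N y) powr p) \<le> u y"
    and avg: "\<And>j. dyadic_average u j x \<le> ennreal a"
  shows "weighted_maximal_operator p F x \<le> ennreal (maximal_constant p * a powr (1 / p))"
  unfolding weighted_maximal_operator_def
proof (rule SUP_least)
  fix n :: nat
  define q where "q = 1 / p - 1"
  have q: "0 < q" using p by (simp add: q_def)
  define N where "N = Suc (Max {j. bit n j})"
  have bits: "j < N" if "bit n j" for j
    using that by (simp add: N_def finite_bits less_Suc_eq_le)
  then have "n \<le> 2 ^ N"
    using less_power_2_iff_bits[of n N] by simp
  from norm_walsh_partial_sum_le[OF F this, of x]
  have "ennreal (norm (walsh_partial_sum n F x)) \<le>
      (\<Sum>j | bit n j. dyadic_average (\<lambda>t. ennreal (norm (F N t))) j x)" .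
  also have "\<dots> \<le> (\<Sum>j | bit n j. ennreal (2 powr (real (N - j) * q) * a powr (1 / p)))"
  proof (rule sum_mono)
    fix j assume "j \<in> {j. bit n j}"
    then have j: "j \<le> N" using bits[of j] by simp
    have FN: "F N \<in> borel_measurable (dyadic_filtration N)" and int: "integrable haar (F N)"
      using F by (simp_all add: dyadic_martingale_def)
    have [measurable]: "F N \<in> borel_measurable haar"
      using int by simp
    show "dyadic_average (\<lambda>t. ennreal (norm (F N t))) j x \<le>
        ennreal (2 powr (real (N - j) * q) * a powr (1 / p))"
      unfolding q_def
      by (rule dyadic_average_le_powr[OF p j a u _ _ _ Fu avg])
         (simp_all add: dyadic_measurable_const[OF FN])
  qed
  also have "\<dots> = ennreal ((\<Sum>j | bit n j. 2 powr (real (N - j) * q)) * a powr (1 / p))"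
    by (simp add: sum_distrib_right)
  also have "\<dots> \<le> ennreal (maximal_constant p * 2 powr (real (rho n) * q) * a powr (1 / p))"
    using sum_bits_powr_le[OF q, of n]
    by (intro ennreal_leI mult_right_mono) (simp_all add: N_def maximal_constant_def q_def)
  finally have "norm (walsh_partial_sum n F x) \<le>
      maximal_constant p * 2 powr (real (rho n) * q) * a powr (1 / p)"
    using maximal_constant_pos[OF p] by (subst (asm) ennreal_le_iff) simp_all
  then show "ennreal (norm (walsh_partial_sum n F x) / 2 powr (real (rho n) * (1 / p - 1))) \<le>
      ennreal (maximal_constant p * a powr (1 / p))"
    by (intro ennreal_leI) (simp add: q_def divide_le_eq mult_ac)
qed

theorem theorem1:
  fixes p :: real
  assumes "0 < p" and "p < 1"
  shows "\<exists>c>0. \<forall>F \<in> (Hp p ::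
           (nat \<Rightarrow> cantor \<Rightarrow> 'a::{real_normed_field, banach, second_countable_topology}) set).
           weak_Lp_norm p (weighted_maximal_operator p F) \<le> ennreal c * Hp_norm p F"
proof (intro exI[of _ "maximal_constant p"] conjI ballI)
  let ?C = "maximal_constant p"
  show C: "0 < ?C"
    by (rule maximal_constant_pos[OF assms])
  fix F :: "nat \<Rightarrow> cantor \<Rightarrow> 'a"
  assume "F \<in> Hp p"
  then have F: "dyadic_martingale F" by (simp add: Hp_def)
  have "integrable haar (F n)" for n
    using F by (simp add: dyadic_martingale_def)
  then have [measurable]: "F n \<in> borel_measurable haar" for n
    by (rule borel_measurable_integrable)
  define u where "u x = ennreal_powr (maximal_function F x) p" for x
  have u [measurable]: "u \<in> borel_measurable haar"
    unfolding u_def maximal_function_def by measurable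
  have Fu: "ennreal (norm (F N y) powr p) \<le> u y" for N y
  proof -
    have "ennreal (norm (F N y) powr p) = ennreal_powr (ennreal (norm (F N y))) p"
      by (simp add: ennreal_powr_ennreal)
    also have "\<dots> \<le> u y"
      unfolding u_def maximal_function_def using assms by (intro ennreal_powr_mono SUP_upper) auto
    finally show ?thesis .
  qed
  let ?W = "weighted_maximal_operator p F" and ?I = "\<integral>\<^sup>+x. u x \<partial>haar"
  have weak: "ennreal (l powr p) * emeasure haar {x. ?W x > ennreal l} \<le> ennreal (?C powr p) * ?I"
    if l: "0 < l" for l
  proof -
    \<comment> \<open>With this level \<open>a\<close> the pointwise bound \<open>C a\<^bsup>1/p\<^esup>\<close> is exactly \<open>l\<close>, so where the operator exceeds \<open>l\<close>
      the dyadic maximal function of \<open>u\<close> must exceed \<open>a\<close>.\<close>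
    define a where "a = (l / ?C) powr p"
    have split: "ennreal (l powr p) = ennreal (?C powr p) * ennreal a"
      using l C by (simp add: a_def powr_divide ennreal_mult[symmetric])
    have "?C * a powr (1 / p) = l"
      using l C assms by (simp add: a_def powr_powr)
    then have "?W x \<le> ennreal l" if "\<And>j. dyadic_average u j x \<le> ennreal a" for x
      using weighted_maximal_operator_le[OF assms F _ u Fu that] by (simp add: a_def)
    then have sub: "{x. ?W x > ennreal l} \<subseteq> {x. ennreal a < (SUP j. dyadic_average u j x)}"
      by (auto simp: less_SUP_iff) (meson leD leI)
    have "{x \<in> space haar. ennreal a < (SUP j. dyadic_average u j x)} \<in> sets haar"
      by measurable
    with sub have "emeasure haar {x. ?W x > ennreal l} \<le>
        emeasure haar {x. ennreal a < (SUP j. dyadic_average u j x)}"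
      by (intro emeasure_mono) simp_all
    then have "ennreal (l powr p) * emeasure haar {x. ?W x > ennreal l} \<le>
        ennreal (l powr p) * emeasure haar {x. ennreal a < (SUP j. dyadic_average u j x)}"
      by (rule mult_left_mono) simp
    also have "\<dots> =
        ennreal (?C powr p) * (ennreal a * emeasure haar {x. ennreal a < (SUP j. dyadic_average u j x)})"
      by (simp only: split mult.assoc)
    also have "\<dots> \<le> ennreal (?C powr p) * ?I"
      by (intro mult_left_mono dyadic_maximal_weak_type u) simp
    finally show ?thesis .
  qed
  have "weak_Lp_norm p ?W \<le> ennreal_powr (ennreal (?C powr p) * ?I) (1 / p)"
    unfolding weak_Lp_norm_def using assms weak
    by (intro ennreal_powr_mono SUP_least) auto
  also have "\<dots> = ennreal ?C * ennreal_powr ?I (1 / p)"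
  proof (cases ?I)
    case (real r)
    then show ?thesis
      using C assms
      by (simp add: ennreal_mult[symmetric] ennreal_powr_ennreal powr_mult powr_powr)
  next
    case top
    then show ?thesis
      using C by (simp add: ennreal_powr_def ennreal_mult_top)
  qed
  also have "\<dots> = ennreal ?C * Hp_norm p F"
    by (simp add: Hp_norm_def Lp_norm_def u_def)
  finally show "weak_Lp_norm p ?W \<le> ennreal ?C * Hp_norm p F" .
qed

end
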